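(* Let $f$ and $g$ be two continuous probability densities with full support $\mathbb{R}$. Suppose that $f$ is symmetric (that is, $f(-x)=f(x)$ for all $x$) and continuously differentiable, and assume that its location score function $\varphi_f(x)=-f'(x)/f(x)$ is invertible over $\mathbb{R}$ and crosses the $x$-axis. Let $n\ge 3$ be an integer. Then $\hat\theta^{(m)}_f=\hat\theta^{(m)}_g$ for all samples of size $m$, for both $m=2$ and $m=n$ simultaneously, if and only if there exist constants $c,d\in(0,\infty)$ such that $g(x)=c(f(x))^d$ for all $x\in\mathbb{R}$, that is, if and only if $f$ and $g$ belong to the same location-based equivalence class.
   Context: A density has full support $\mathbb{R}$ if it is strictly positive on $\mathbb{R}$ (densities are with respect to Lebesgue measure). Location MLE: for a density $f$, $m\ge 1$ and a sample $\mathbf{x}^{(m)}=(x_1,\dots,x_m)\in\mathbb{R}^m$, the maximum likelihood estimator $\hat\theta^{(m)}_f(\mathbf{x}^{(m)})$ of the location parameter is a maximizer over $\theta\in\mathbb{R}$ of $\prod_{i=1}^m f(x_i-\theta)$. "$\hat\theta^{(m)}_f=\hat\theta^{(m)}_g$ for all samples of size $m$" means that the $f$-MLE is also an MLE for $g$: for every $\mathbf{x}^{(m)}\in\mathbb{R}^m$, $$\sum_{i=1}^m\log g\bigl(x_i-\hat\theta^{(m)}_f(\mathbf{x}^{(m)})\bigr)\ \ge\ \sum_{i=1}^m\log g(x_i-\theta)\quad\text{for all }\theta\in\mathbb{R}.$$ Location-based equivalence class of $f$: the set of all densities of the form $c f^d$ with $d>0$ and $c$ the normalizing constant. *)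

theory Defs
  imports "HOL-Analysis.Analysis"
begin

definition prob_density :: "(real \<Rightarrow> real) \<Rightarrow> bool" where
  "prob_density f \<longleftrightarrow> (\<forall>x. 0 \<le> f x) \<and> has_bochner_integral lborel f 1"

definition loc_score :: "(real \<Rightarrow> real) \<Rightarrow> real \<Rightarrow> real" where
  "loc_score f x = - deriv f x / f x"

definition crosses_axis :: "(real \<Rightarrow> real) \<Rightarrow> bool" where
  "crosses_axis \<phi> \<longleftrightarrow> (\<exists>a b. \<phi> a < 0 \<and> 0 < \<phi> b)"

text \<open>A sample of size \<open>m\<close> is given by the values \<open>x 0, \<dots>, x (m - 1)\<close> of a
  function \<open>x\<close>; the other values of \<open>x\<close> are never used.  The maximizer is selected by
  \<open>arg_max_on\<close>, which is unspecified when no maximizer exists and an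
  arbitrary fixed maximizer when there are several.\<close>

definition loc_mle :: "(real \<Rightarrow> real) \<Rightarrow> nat \<Rightarrow> (nat \<Rightarrow> real) \<Rightarrow> real" where
  "loc_mle f m x = arg_max_on (\<lambda>\<theta>. \<Prod>i<m. f (x i - \<theta>)) UNIV"

text \<open>The \<open>f\<close>-MLE is also a \<open>g\<close>-MLE for every sample of size \<open>m\<close>.  This is the meaning of
  equality of the two estimators; it is not symmetric in \<open>f\<close> and \<open>g\<close>, and it does not
  require the maximizer for \<open>g\<close> to be unique.  It is meant for strictly positive \<open>g\<close>,
  because \<open>ln\<close> carries no information about the likelihood where \<open>g\<close> vanishes.\<close>

definition mle_coincide :: "(real \<Rightarrow> real) \<Rightarrow> (real \<Rightarrow> real) \<Rightarrow> nat \<Rightarrow> bool" where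
  "mle_coincide f g m \<longleftrightarrow>
     (\<forall>x \<theta>. (\<Sum>i<m. ln (g (x i - loc_mle f m x))) \<ge> (\<Sum>i<m. ln (g (x i - \<theta>))))"

text \<open>The normalizing constant \<open>c\<close> is fixed by the requirement that \<open>h\<close> be a density.\<close>

definition loc_class :: "(real \<Rightarrow> real) \<Rightarrow> (real \<Rightarrow> real) set" where
  "loc_class f = {h. prob_density h \<and> (\<exists>c>0. \<exists>d>0. \<forall>x. h x = c * f x powr d)}"

end

theory Submission
  imports Defs
begin

text \<open>Put \<open>u = - ln f\<close>, \<open>v = - ln g\<close> and \<open>\<phi> = u'\<close>.  An injective continuous odd score is strictly
  increasing, since otherwise \<open>f\<close> would be bounded below by \<open>f 0\<close> and not integrable.  Hence \<open>u\<close> is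
  strictly convex and the \<open>f\<close>-MLE is the unique zero of \<open>\<theta> \<mapsto> \<Sum> \<phi> (x i - \<theta>)\<close>.

  For \<open>m = 2\<close> the MLE is the midpoint, so \<open>v a + v (- a) \<le> v (a + t) + v (- a + t)\<close>.  This says that
  the second differences of the even part of \<open>v\<close> dominate the differences of its odd part.  The odd
  part therefore vanishes, and \<open>v\<close> is midpoint convex, hence convex, and has an odd subgradient \<open>p\<close>.

  For \<open>m = n\<close>, \<open>\<Sum> \<phi> (x i) > 0\<close> means that the MLE is positive, and convexity of \<open>v\<close> then gives
  \<open>\<Sum> p (x i) \<ge> 0\<close>.  The samples \<open>a, b, - c, 0, \<dots>, 0\<close> show that \<open>\<phi> c < \<phi> a + \<phi> b\<close> implies
  \<open>p c \<le> p a + p b\<close>, so that \<open>p\<close> is an additive monotone function of \<open>\<phi>\<close>, that is \<open>p = d \<phi>\<close>.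
  Integrating, \<open>v - d u\<close> is constant, and \<open>d > 0\<close> because constants are not integrable.\<close>

section \<open>Convexity and evenness from midpoint inequalities\<close>

text \<open>If the graph rose above a chord, the excess over that chord would attain a positive
  maximum at an interior point, against the midpoint inequality there.\<close>

lemma midpoint_convex_continuous_imp_convex:
  fixes w :: "real \<Rightarrow> real"
  assumes cont: "continuous_on UNIV w"
    and mid: "\<And>a t. 2 * w a \<le> w (a + t) + w (a - t)"
  shows "convex_on UNIV w"
proof (rule convex_on_linorderI)
  fix t x y :: real
  assume t: "t > 0" "t < 1" and xy: "x < y"
  define s where "s = (w y - w x) / (y - x)"
  define h where "h = (\<lambda>z. w z - (w x + s * (z - x)))"
  have hx: "h x = 0" and hy: "h y = 0"
    using xy by (auto simp: h_def s_def)
  have conth: "continuous_on {x..y} h"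
    unfolding h_def by (intro continuous_intros continuous_on_subset[OF cont]) auto
  have midh: "2 * h a \<le> h (a + r) + h (a - r)" for a r
    using mid[of a r] by (simp add: h_def algebra_simps)
  obtain m where m: "m \<in> {x..y}" "\<And>z. z \<in> {x..y} \<Longrightarrow> h z \<le> h m"
    using continuous_attains_sup[OF _ _ conth] xy by fastforce
  have "h m \<le> 0"
  proof (rule ccontr)
    assume "\<not> h m \<le> 0"
    define K where "K = {z \<in> {x..y}. h z = h m}"
    have "closed K" unfolding K_def by (rule continuous_closed_preimage_constant[OF conth]) simp
    moreover have "bounded K" by (rule bounded_subset[of "{x..y}"]) (auto simp: K_def)
    ultimately have "compact K" by (simp add: compact_eq_bounded_closed)
    moreover have "K \<noteq> {}" using m by (auto simp: K_def)
    \<comment> \<open>The leftmost maximizer makes \<open>h (c - r) < h m\<close> strict.\<close>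
    ultimately obtain c where c: "c \<in> K" "\<And>z. z \<in> K \<Longrightarrow> c \<le> z"
      using compact_attains_inf[of K] by metis
    have hc: "h c = h m" and "c \<in> {x..y}" using c by (auto simp: K_def)
    moreover have "c \<noteq> x" "c \<noteq> y" using hc hx hy \<open>\<not> h m \<le> 0\<close> by auto
    ultimately have cxy: "x < c" "c < y" by auto
    define r where "r = min (c - x) (y - c)"
    have r: "r > 0" "c - r \<in> {x..y}" "c + r \<in> {x..y}" using cxy by (auto simp: r_def)
    have "c - r \<notin> K" using c(2)[of "c - r"] r(1) by auto
    hence "h (c - r) < h m" using m(2)[OF r(2)] r(2) by (auto simp: K_def)
    moreover have "h (c + r) \<le> h m" using m(2)[OF r(3)] .
    ultimately show False using midh[of c r] hc by linarith
  qed
  define z where "z = (1 - t) *\<^sub>R x + t *\<^sub>R y"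
  have zx: "z - x = t * (y - x)" by (simp add: z_def algebra_simps)
  have "z \<in> {x..y}"
    using t xy convexD[OF convex_real_interval(5)[of x y], of x y "1 - t" t] by (auto simp: z_def)
  hence "h z \<le> 0" using m(2) \<open>h m \<le> 0\<close> by fastforce
  hence "w z \<le> w x + s * (t * (y - x))" by (simp add: h_def zx)
  also have "\<dots> = (1 - t) * w x + t * w y" using xy by (simp add: s_def field_simps)
  finally show "w ((1 - t) *\<^sub>R x + t *\<^sub>R y) \<le> (1 - t) * w x + t * w y"
    by (simp add: z_def)
qed auto

text \<open>Along an arithmetic progression the second differences of \<open>e\<close> telescope to a first difference
  that vanishes with the step size.\<close>

lemma constant_if_difference_le_second_difference:
  fixes e w :: "real \<Rightarrow> real"
  assumes conte: "continuous_on UNIV e" and contw: "continuous_on UNIV w"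
    and le: "\<And>a t. \<bar>w (a + t) - w (a - t)\<bar> \<le> e (a + t) + e (a - t) - 2 * e a"
  shows "w x = w y"
proof -
  \<comment> \<open>The hypothesis is summed over the centres \<open>x + h\<close>, ...,
    \<open>x + N * h\<close>; both sides telescope.\<close>
  have tele: "\<bar>w (x + real (Suc N) * h) + w (x + real N * h) - w (x + h) - w x\<bar>
      \<le> e (x + real (Suc N) * h) - e (x + real N * h) - e (x + h) + e x" for N h
  proof (induction N)
    case 0
    show ?case by simp
  next
    case (Suc N)
    have eq: "x + real (Suc N) * h + h = x + real (Suc (Suc N)) * h"
      "x + real (Suc N) * h - h = x + real N * h"
      by (auto simp: algebra_simps)
    show ?case using Suc le[of "x + real (Suc N) * h" h, unfolded eq] by linarith
  qed
  \<comment> \<open>This step size puts the last node at \<open>y\<close>. As \<open>N\<close>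
    grows, the right-hand side tends to 0 and the left-hand side to
    \<open>2 * \<bar>w y - w x\<bar>\<close>.\<close>
  define h where "h = (\<lambda>N. (y - x) / real (Suc N))"
  have h0: "h \<longlonglongrightarrow> 0"
    unfolding h_def by (rule LIMSEQ_Suc) (rule lim_const_over_n)
  have lim: "(\<lambda>N. q (c + s * h N)) \<longlonglongrightarrow> q c" if "continuous_on UNIV q" for q :: "real \<Rightarrow> real" and c s
  proof -
    have "(\<lambda>N. c + s * h N) \<longlonglongrightarrow> c + s * 0" by (intro tendsto_intros h0)
    moreover have "isCont q c" using that by (simp add: continuous_on_eq_continuous_at)
    ultimately show ?thesis using isCont_tendsto_compose by fastforce
  qed
  have "\<bar>w y + w (y + (-1) * h N) - w (x + 1 * h N) - w x\<bar>
      \<le> e y - e (y + (-1) * h N) - e (x + 1 * h N) + e x" for N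
  proof -
    have "x + real (Suc N) * h N = y" by (simp add: h_def)
    moreover have "x + real N * h N = y + (-1) * h N"
      using calculation by (simp add: algebra_simps)
    ultimately show ?thesis using tele[of N "h N"] by simp
  qed
  hence "\<bar>w y + w y - w x - w x\<bar> \<le> e y - e y - e x + e x"
    by (intro LIMSEQ_le[of "\<lambda>N. \<bar>w y + w (y + (-1) * h N) - w (x + 1 * h N) - w x\<bar>" _
          "\<lambda>N. e y - e (y + (-1) * h N) - e (x + 1 * h N) + e x"])
       (intro tendsto_intros lim conte contw exI allI impI | simp)+
  thus ?thesis by simp
qed

lemma even_convex_if_symmetric_pairs_minimal:
  fixes v :: "real \<Rightarrow> real"
  assumes cont: "continuous_on UNIV v"
    and le: "\<And>a t. v a + v (- a) \<le> v (a + t) + v (- a + t)"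
  shows "v (- x) = v x" and "convex_on UNIV v"
proof -
  define e where "e = (\<lambda>x. (v x + v (- x)) / 2)"
  define w where "w = (\<lambda>x. (v x - v (- x)) / 2)"
  have cm: "continuous_on UNIV (\<lambda>x. v (- x))"
    by (rule continuous_on_compose2[OF cont]) (auto intro: continuous_intros)
  \<comment> \<open>Replacing \<open>t\<close> by \<open>- t\<close> flips the sign of the
    \<open>w\<close> terms only, which yields the absolute value.\<close>
  have diff: "\<bar>w (a + t) - w (a - t)\<bar> \<le> e (a + t) + e (a - t) - 2 * e a" for a t
    unfolding e_def w_def abs_le_iff using le[of a t] le[of a "- t"] by (auto simp: field_simps)
  have "w x = w 0" for x
    by (rule constant_if_difference_le_second_difference[of e])
       (use diff in \<open>auto simp: e_def w_def intro!: continuous_intros cont cm\<close>)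
  thus even: "v (- x) = v x" for x by (simp add: w_def)
  have "2 * v a \<le> v (a + t) + v (a - t)" for a t
    using le[of a t] even[of a] even[of "a - t"] by simp
  thus "convex_on UNIV v" by (rule midpoint_convex_continuous_imp_convex[OF cont])
qed

section \<open>Subgradients\<close>

text \<open>By evenness, \<open>- q (- x)\<close> is a subgradient at \<open>x\<close> whenever
  \<open>q (- x)\<close> is one at \<open>- x\<close>; averaging it with \<open>q x\<close> gives an
  odd choice.\<close>

lemma even_convex_odd_subgradient:
  fixes v :: "real \<Rightarrow> real"
  assumes "convex_on UNIV v" and even: "\<And>x. v (- x) = v x"
  obtains p where "\<And>x y. v x + p x * (y - x) \<le> v y" and "\<And>x. p (- x) = - p x"
proof -
  define q where "q = (\<lambda>x. Inf ((\<lambda>t. (v x - v t) / (x - t)) ` ({x<..} \<inter> UNIV)))"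
  have q: "v x + q x * (y - x) \<le> v y" for x y
    unfolding q_def by (rule convex_le_Inf_differential[OF assms(1)]) auto
  show ?thesis
  proof (rule that[of "\<lambda>x. (q x - q (- x)) / 2"])
    show "v x + (q x - q (- x)) / 2 * (y - x) \<le> v y" for x y
      using q[of x y] q[of "- x" "- y"] by (simp add: even field_simps)
  qed (simp add: field_simps)
qed

text \<open>The subgradient inequalities at \<open>x\<close> and at \<open>y\<close> trap the
  difference quotient between \<open>p x\<close> and \<open>p y\<close>.\<close>

lemma continuous_subgradient_imp_DERIV:
  fixes v p :: "real \<Rightarrow> real"
  assumes sub: "\<And>x y. v x + p x * (y - x) \<le> v y" and cont: "isCont p x"
  shows "(v has_real_derivative p x) (at x)"
proof -
  have "\<bar>(v y - v x) / (y - x) - p x\<bar> \<le> \<bar>p y - p x\<bar>" if "y \<noteq> x" for y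
  proof -
    have "\<bar>v y - v x - p x * (y - x)\<bar> \<le> \<bar>(p y - p x) * (y - x)\<bar>"
      using sub[of x y] sub[of y x] by (simp add: algebra_simps)
    moreover have "(v y - v x) / (y - x) - p x = (v y - v x - p x * (y - x)) / (y - x)"
      using that by (simp add: field_simps)
    ultimately show ?thesis using that by (simp add: abs_mult divide_le_eq)
  qed
  hence "\<forall>\<^sub>F y in at x. norm ((v y - v x) / (y - x) - p x) \<le> \<bar>p y - p x\<bar>"
    by (simp add: eventually_at_filter)
  moreover have "((\<lambda>y. \<bar>p y - p x\<bar>) \<longlongrightarrow> 0) (at x)"
    using cont unfolding isCont_def by (intro tendsto_rabs_zero LIM_zero)
  ultimately have "((\<lambda>y. (v y - v x) / (y - x) - p x) \<longlongrightarrow> 0) (at x)"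
    by (rule Lim_null_comparison)
  thus ?thesis by (simp add: has_field_derivative_iff LIM_zero_cancel)
qed

section \<open>Proportionality of the subgradient to the score\<close>

text \<open>The strict inequality in the hypothesis forbids a direct appeal to Cauchy's equation.
  Instead \<open>p x\<close> and \<open>p y\<close> are compared with integer multiples of \<open>p a\<close>, where \<open>a \<rightarrow> 0\<close>.\<close>

lemma odd_subadditive_imp_proportional:
  fixes \<phi> p :: "real \<Rightarrow> real"
  assumes cont: "continuous_on UNIV \<phi>" and mono: "strict_mono \<phi>"
    and odd\<phi>: "\<And>x. \<phi> (- x) = - \<phi> x" and oddp: "\<And>x. p (- x) = - p x"
    and sub: "\<And>a b c. \<phi> c < \<phi> a + \<phi> b \<Longrightarrow> p c \<le> p a + p b"
  obtains d where "d \<ge> 0" and "\<And>x. p x = d * \<phi> x"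
proof -
  have \<phi>0: "\<phi> 0 = 0" and p0: "p 0 = 0" using odd\<phi>[of 0] oddp[of 0] by auto
  have pos: "0 < \<phi> x \<longleftrightarrow> 0 < x" for x using strict_mono_less[OF mono, of 0 x] \<phi>0 by simp
  have monop: "p x \<le> p y" if "\<phi> x < \<phi> y" for x y using sub[of x y 0] that \<phi>0 p0 by simp
  have super: "p a + p b \<le> p c" if "\<phi> a + \<phi> b < \<phi> c" for a b c
    using sub[of "- c" "- a" "- b"] that by (simp add: odd\<phi> oddp)
  have ivt: "\<exists>z. \<phi> z = \<tau>" if "\<phi> a < \<tau>" "\<tau> < \<phi> b" for a b \<tau>
  proof -
    have "a \<le> b" using that strict_mono_less_eq[OF mono] by (meson less_trans less_imp_le)
    thus ?thesis using IVT'[of \<phi> a \<tau> b] that continuous_on_subset[OF cont] by fastforce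
  qed
  have upper: "p x \<le> real k * p a" if "a > 0" "\<phi> x < real k * \<phi> a" for a x k
    using that(2)
  proof (induction k arbitrary: x)
    case 0
    thus ?case using monop[of x 0] by (simp add: \<phi>0 p0)
  next
    case (Suc k)
    have pa: "\<phi> a > 0" "p a \<ge> 0" using that(1) pos monop[of 0 a] by (auto simp: \<phi>0 p0)
    show ?case
    proof (cases "\<phi> x \<le> 0")
      case True
      hence "p x \<le> 0" using monop[of x 0] \<phi>0 p0 strict_mono_eq[OF mono, of x 0] by fastforce
      thus ?thesis using pa by (simp add: order_trans[OF _ mult_nonneg_nonneg])
    next
      case False
      \<comment> \<open>A value strictly in between leaves room for both strict hypotheses, that of
        \<open>sub\<close> and that of the induction; \<open>\<tau> < \<phi> x\<close> lets the
        intermediate value theorem find \<open>y\<close>.\<close>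
      have "\<phi> x - \<phi> a < min (real k * \<phi> a) (\<phi> x)" using Suc.prems pa by (simp add: algebra_simps)
      then obtain \<tau> where \<tau>: "\<phi> x - \<phi> a < \<tau>" "\<tau> < real k * \<phi> a" "\<tau> < \<phi> x"
        using dense by (metis min_less_iff_conj)
      obtain y where y: "\<phi> y = \<tau>" using ivt[of "- a" \<tau> x] \<tau> False by (auto simp: odd\<phi>)
      have "p x \<le> p a + p y" by (rule sub) (use y \<tau> in linarith)
      also have "p y \<le> real k * p a" using Suc.IH y \<tau> by simp
      finally show ?thesis by (simp add: algebra_simps)
    qed
  qed
  have lower: "real k * p a \<le> p x" if "a > 0" "real k * \<phi> a < \<phi> x" for a x k
    using that(2)
  proof (induction k arbitrary: x)
    case 0
    thus ?case using monop[of 0 x] by (simp add: \<phi>0 p0)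
  next
    case (Suc k)
    have "real k * \<phi> a < \<phi> x - \<phi> a" using Suc.prems by (simp add: algebra_simps)
    then obtain \<tau> where \<tau>: "real k * \<phi> a < \<tau>" "\<tau> < \<phi> x - \<phi> a" using dense by blast
    have "\<phi> a > 0" using that(1) pos by simp
    moreover from this have "0 \<le> real k * \<phi> a" by simp
    ultimately have "0 < \<tau>" "\<tau> < \<phi> x" using \<tau> by linarith+
    then obtain y where y: "\<phi> y = \<tau>" using ivt[of 0 \<tau> x] by (auto simp: \<phi>0)
    have "p a + p y \<le> p x" by (rule super) (use y \<tau> in linarith)
    moreover have "real k * p a \<le> p y" using Suc.IH y \<tau> by simp
    ultimately show ?case by (simp add: algebra_simps)
  qed
  have approx: "\<phi> y * p x \<le> \<phi> x * p y + p a * (\<phi> x + \<phi> y)" if "x > 0" "y > 0" "a > 0" for x y a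
  proof -
    have pa: "\<phi> a > 0" "p a \<ge> 0" using that(3) pos monop[of 0 a] by (auto simp: \<phi>0 p0)
    have px: "\<phi> x > 0" "\<phi> y > 0" using that pos by auto
    define k where "k = nat \<lfloor>\<phi> x / \<phi> a\<rfloor> + 1"
    have "real k = of_int \<lfloor>\<phi> x / \<phi> a\<rfloor> + 1" using pa px by (simp add: k_def)
    hence "\<phi> x / \<phi> a < real k" "real k \<le> \<phi> x / \<phi> a + 1" by linarith+
    hence k: "\<phi> x < real k * \<phi> a" "real k * \<phi> a \<le> \<phi> x + \<phi> a" using pa by (auto simp: field_simps)
    \<comment> \<open>The ceiling minus one, rather than the floor, keeps
      \<open>l * \<phi> a\<close> strictly below \<open>\<phi> y\<close> even when the quotient is
      an integer.\<close>
    define l where "l = nat (\<lceil>\<phi> y / \<phi> a\<rceil> - 1)"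
    have "\<lceil>\<phi> y / \<phi> a\<rceil> \<ge> 1" using pa px by (simp add: one_le_ceiling)
    hence "real l = of_int \<lceil>\<phi> y / \<phi> a\<rceil> - 1" by (simp add: l_def)
    hence "real l < \<phi> y / \<phi> a" "\<phi> y / \<phi> a \<le> real l + 1" by linarith+
    hence l: "real l * \<phi> a < \<phi> y" "\<phi> y - \<phi> a \<le> real l * \<phi> a" using pa by (auto simp: field_simps)
    have "\<phi> a * p x \<le> \<phi> a * (real k * p a)"
      using upper[OF that(3) k(1)] pa by (intro mult_left_mono) auto
    also have "\<dots> = (real k * \<phi> a) * p a" by simp
    also have "\<dots> \<le> (\<phi> x + \<phi> a) * p a" using k pa by (intro mult_right_mono) auto
    finally have 1: "\<phi> y * (\<phi> a * p x) \<le> \<phi> y * ((\<phi> x + \<phi> a) * p a)" using px by simp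
    have "(\<phi> y - \<phi> a) * p a \<le> (real l * \<phi> a) * p a" using l pa by (intro mult_right_mono) auto
    also have "\<dots> = \<phi> a * (real l * p a)" by simp
    also have "\<dots> \<le> \<phi> a * p y" using lower[OF that(3) l(1)] pa by (intro mult_left_mono) auto
    finally have 2: "\<phi> x * ((\<phi> y - \<phi> a) * p a) \<le> \<phi> x * (\<phi> a * p y)" using px by simp
    have "\<phi> a * (\<phi> y * p x) \<le> \<phi> a * (\<phi> x * p y + p a * (\<phi> x + \<phi> y))"
      using 1 2 by (simp add: algebra_simps)
    thus ?thesis using pa by simp
  qed
  have small: "\<exists>a>0. p a < \<epsilon>" if "\<epsilon> > 0" for \<epsilon>
  proof -
    obtain N :: nat where N: "p 1 < real N * \<epsilon>" using reals_Archimedean3[OF \<open>\<epsilon> > 0\<close>] by blast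
    have "p 1 \<ge> 0" "\<phi> 1 > 0" using pos[of 1] monop[of 0 1] by (auto simp: \<phi>0 p0)
    have "N > 0" using N \<open>p 1 \<ge> 0\<close> by (cases N) auto
    \<comment> \<open>With \<open>N + 1\<close> in the denominator,
      \<open>N * \<phi> a < \<phi> 1\<close> is strict, so \<open>lower\<close> gives
      \<open>N * p a \<le> p 1 < N * \<epsilon>\<close>.\<close>
    have "0 < \<phi> 1 / (real N + 1)" "\<phi> 1 / (real N + 1) < \<phi> 1"
      using \<open>\<phi> 1 > 0\<close> \<open>N > 0\<close> by (auto simp: field_simps)
    then obtain a where a: "\<phi> a = \<phi> 1 / (real N + 1)" using ivt[of 0 _ 1] by (auto simp: \<phi>0)
    have "a > 0" using a \<open>\<phi> 1 > 0\<close> pos[of a] by simp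
    have "real N * \<phi> a < \<phi> 1" using a \<open>\<phi> 1 > 0\<close> by (simp add: divide_less_eq)
    hence "real N * p a < real N * \<epsilon>" using lower[OF \<open>a > 0\<close>] N by fastforce
    thus ?thesis using \<open>a > 0\<close> \<open>N > 0\<close> by auto
  qed
  have le: "\<phi> y * p x \<le> \<phi> x * p y" if "x > 0" "y > 0" for x y
  proof (rule field_le_epsilon)
    fix \<epsilon> :: real assume "\<epsilon> > 0"
    have s: "\<phi> x + \<phi> y > 0" using that pos by (simp add: add_pos_pos)
    then obtain a where a: "a > 0" "p a < \<epsilon> / (\<phi> x + \<phi> y)"
      using small[of "\<epsilon> / (\<phi> x + \<phi> y)"] \<open>\<epsilon> > 0\<close> by auto
    hence "p a * (\<phi> x + \<phi> y) \<le> \<epsilon>" using s by (simp add: field_simps)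
    thus "\<phi> y * p x \<le> \<phi> x * p y + \<epsilon>" using approx[OF that a(1)] by linarith
  qed
  have \<phi>1: "\<phi> 1 > 0" using pos[of 1] by simp
  \<comment> \<open>Exchanging the two points in \<open>le\<close> turns the inequality into an
    equality.\<close>
  have eq: "p x = p 1 / \<phi> 1 * \<phi> x" if "x > 0" for x
    using le[of x 1] le[of 1 x] that \<phi>1 by (simp add: field_simps)
  show ?thesis
  proof (rule that[of "p 1 / \<phi> 1"])
    show "p 1 / \<phi> 1 \<ge> 0" using monop[of 0 1] \<phi>1 by (simp add: \<phi>0 p0)
    show "p x = p 1 / \<phi> 1 * \<phi> x" for x
      using eq[of x] eq[of "- x"] by (cases x "0 :: real" rule: linorder_cases) (auto simp: odd\<phi> oddp \<phi>0 p0)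
  qed
qed

section \<open>Densities and the location MLE\<close>

text \<open>A positive lower bound on the half-line would force infinite mass. This rules out a
  decreasing score for \<open>f\<close> and the exponent 0 for \<open>g\<close>.\<close>

lemma prob_density_not_bounded_below:
  assumes "prob_density f" and "c > 0" shows "\<exists>x\<ge>0. f x < c"
proof (rule ccontr)
  assume "\<not> (\<exists>x\<ge>0. f x < c)"
  hence le: "c \<le> f x" if "x \<ge> 0" for x using that by force
  have f: "has_bochner_integral lborel f 1" "\<And>x. 0 \<le> f x"
    using assms(1) by (auto simp: prob_density_def)
  have "c * N \<le> 1" if "N \<ge> 0" for N :: real
  proof -
    have "has_bochner_integral lborel (\<lambda>x. c * indicator {0..N} x) (c * measure lborel {0..N})"
      by (intro has_bochner_integral_mult_right has_bochner_integral_real_indicator)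
        (auto simp: emeasure_lborel_Icc_eq)
    hence "c * measure lborel {0..N} = (\<integral>x. c * indicator {0..N} x \<partial>lborel)"
      and "integrable lborel (\<lambda>x. c * indicator {0..N} x :: real)"
      by (auto simp: has_bochner_integral_iff)
    moreover have "integrable lborel f" "(\<integral>x. f x \<partial>lborel) = 1"
      using f(1) by (auto simp: has_bochner_integral_iff)
    moreover have "c * indicator {0..N} x \<le> f x" for x
      using le f(2) by (simp add: indicator_def)
    ultimately have "c * measure lborel {0..N} \<le> 1"
      using integral_mono[of lborel "\<lambda>x. c * indicator {0..N} x" f] by metis
    thus ?thesis using that by simp
  qed
  from this[of "2 / c"] show False using assms(2) by simp
qed

text \<open>The negative log-likelihood is convex, so a zero of the summed score is a global
  maximizer of the likelihood. Hence \<open>loc_mle\<close> is a genuine maximizer, and its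
  derivative condition is stationarity.\<close>

lemma mle_stationary_and_maximal:
  fixes f \<phi> :: "real \<Rightarrow> real"
  assumes fpos: "\<And>x. f x > 0"
    and der: "\<And>x. ((\<lambda>x. - ln (f x)) has_real_derivative \<phi> x) (at x)"
    and cont: "continuous_on UNIV \<phi>" and mono: "strict_mono \<phi>" and \<phi>0: "\<phi> 0 = 0"
    and m: "m > 0"
  shows "(\<Sum>i<m. \<phi> (x i - loc_mle f m x)) = 0"
    and "(\<Sum>i<m. ln (f (x i - \<theta>))) \<le> (\<Sum>i<m. ln (f (x i - loc_mle f m x)))"
proof -
  define u where "u = (\<lambda>x. - ln (f x))"
  have deru: "(u has_real_derivative \<phi> x) (at x)" for x using der by (simp add: u_def)
  have convu: "convex_on UNIV u"
    using convex_on_realI[of UNIV u \<phi>] deru mono by (auto simp: strict_mono_less_eq)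
  have sub: "u a + \<phi> a * (b - a) \<le> u b" for a b
    using convex_on_imp_above_tangent[OF convu, of a b "\<phi> a"] deru[of a] by (simp add: algebra_simps)
  define U where "U = (\<lambda>\<theta>. \<Sum>i<m. u (x i - \<theta>))"
  have prod: "(\<Prod>i<m. f (x i - \<theta>)) = exp (- U \<theta>)" for \<theta>
    by (simp add: U_def u_def sum_negf exp_sum fpos)
  obtain \<theta>0 where \<theta>0: "(\<Sum>i<m. \<phi> (x i - \<theta>0)) = 0"
  proof -
    define S where "S = (\<lambda>\<theta>. \<Sum>i<m. \<phi> (x i - \<theta>))"
    \<comment> \<open>The summed score is nonnegative at the sample minimum and nonpositive at the
      maximum, so it vanishes in between.\<close>
    define a b where "a = Min (x ` {..<m})" and "b = Max (x ` {..<m})"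
    have ab: "a \<le> x i" "x i \<le> b" if "i < m" for i using that by (auto simp: a_def b_def)
    have "S b \<le> 0" unfolding S_def
      by (rule sum_nonpos) (use ab strict_mono_less_eq[OF mono, of _ 0] \<phi>0 in auto)
    moreover have "0 \<le> S a" unfolding S_def
      by (rule sum_nonneg) (use ab strict_mono_less_eq[OF mono, of 0] \<phi>0 in auto)
    moreover have "a \<le> b" using ab[OF m] by linarith
    moreover have "continuous_on {a..b} S" unfolding S_def
      by (intro continuous_intros continuous_on_compose2[OF cont]) auto
    ultimately show ?thesis using IVT2'[of S b 0 a] that unfolding S_def by blast
  qed
  have "U \<theta>0 \<le> U \<theta>" for \<theta>
  proof -
    have "U \<theta>0 + (\<Sum>i<m. \<phi> (x i - \<theta>0)) * (\<theta>0 - \<theta>)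
        = (\<Sum>i<m. u (x i - \<theta>0) + \<phi> (x i - \<theta>0) * ((x i - \<theta>) - (x i - \<theta>0)))"
      by (simp add: U_def sum.distrib sum_distrib_right)
    also have "\<dots> \<le> U \<theta>" unfolding U_def by (intro sum_mono sub)
    finally show ?thesis using \<theta>0 by simp
  qed
  hence "is_arg_max (\<lambda>\<theta>. \<Prod>i<m. f (x i - \<theta>)) (\<lambda>\<theta>. \<theta> \<in> UNIV) \<theta>0"
    by (simp add: is_arg_max_linorder prod)
  hence "is_arg_max (\<lambda>\<theta>. \<Prod>i<m. f (x i - \<theta>)) (\<lambda>\<theta>. \<theta> \<in> UNIV) (loc_mle f m x)"
    unfolding loc_mle_def arg_max_on_def arg_max_def by (rule someI)
  hence max: "U (loc_mle f m x) \<le> U \<theta>" for \<theta> by (simp add: is_arg_max_linorder prod)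
  thus "(\<Sum>i<m. ln (f (x i - \<theta>))) \<le> (\<Sum>i<m. ln (f (x i - loc_mle f m x)))"
    by (simp add: U_def u_def sum_negf)
  have "((\<lambda>\<theta>. u (x i - \<theta>)) has_real_derivative - \<phi> (x i - \<theta>)) (at \<theta>)" for i \<theta>
  proof -
    have "((\<lambda>\<theta>. x i - \<theta>) has_real_derivative - 1) (at \<theta>)"
      by (auto intro!: derivative_eq_intros)
    thus ?thesis
      using DERIV_chain2[where f = u and g = "\<lambda>\<theta>. x i - \<theta>" and x = \<theta> and s = UNIV, OF deru] by fastforce
  qed
  hence "(U has_real_derivative (\<Sum>i<m. - \<phi> (x i - loc_mle f m x))) (at (loc_mle f m x))"
    unfolding U_def by (intro DERIV_sum) auto
  hence "(\<Sum>i<m. - \<phi> (x i - loc_mle f m x)) = 0"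
    by (rule DERIV_local_min[where d = 1]) (use max in auto)
  thus "(\<Sum>i<m. \<phi> (x i - loc_mle f m x)) = 0" by (simp add: sum_negf)
qed


section \<open>The characterization\<close>

theorem theorem4p2:
  fixes f g :: "real \<Rightarrow> real" and n :: nat
  assumes "prob_density f" and "continuous_on UNIV f" and "\<And>x. f x > 0"
    and "prob_density g" and "continuous_on UNIV g" and "\<And>x. g x > 0"
    and "\<And>x. f (- x) = f x"
    and "f C1_differentiable_on UNIV"
    and "inj (loc_score f)"
    and "crosses_axis (loc_score f)"
    and "n \<ge> 3"
  shows "(mle_coincide f g 2 \<and> mle_coincide f g n \<longleftrightarrow>
            (\<exists>c>0. \<exists>d>0. \<forall>x. g x = c * f x powr d)) \<and>
         (mle_coincide f g 2 \<and> mle_coincide f g n \<longleftrightarrow> g \<in> loc_class f)"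
proof -
  define \<phi> where "\<phi> = loc_score f"
  note fpos = assms(3) and gpos = assms(6) and sym = assms(7)
  obtain D where D: "\<And>x. (f has_real_derivative D x) (at x)" and contD: "continuous_on UNIV D"
    using assms(8) by (auto simp: C1_differentiable_on_def has_real_derivative_iff_has_vector_derivative)
  have \<phi>D: "\<phi> x = - D x / f x" for x using DERIV_imp_deriv[OF D] by (simp add: \<phi>_def loc_score_def)
  have fne: "f x \<noteq> 0" for x using fpos[of x] by simp
  have cont: "continuous_on UNIV \<phi>"
    unfolding \<phi>D using fne by (intro continuous_intros contD assms(2)) auto
  have der: "((\<lambda>x. - ln (f x)) has_real_derivative \<phi> x) (at x)" for x
    using fpos[of x] by (auto simp: \<phi>D field_simps intro!: derivative_eq_intros D)
  have odd: "\<phi> (- x) = - \<phi> x" for x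
  proof -
    have "(f has_real_derivative - D (- x)) (at x)"
      using D[of "- x"] DERIV_mirror[of f "D (- x)" x] by (simp add: sym)
    hence "D x = - D (- x)" using D DERIV_unique by blast
    thus ?thesis by (simp add: \<phi>D sym)
  qed
  have \<phi>0: "\<phi> 0 = 0" using odd[of 0] by simp
  have mono: "strict_mono \<phi>"
  proof (rule ccontr)
    assume "\<not> strict_mono \<phi>"
    hence anti: "strict_antimono_on UNIV \<phi>"
      using injective_eq_monotone_map[OF is_interval_univ cont] assms(9) by (auto simp: \<phi>_def)
    have "f 0 \<le> f x" if "x \<ge> 0" for x
    proof (cases "x = 0")
      case False
      have "0 \<le> D y" if "0 \<le> y" for y
      proof -
        have "\<phi> y \<le> 0"
          using monotone_onD[OF anti, of 0 y] \<phi>0 that by (cases "y = 0") auto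
        thus ?thesis using fpos[of y] by (simp add: \<phi>D zero_le_divide_iff)
      qed
      thus ?thesis using D by (intro DERIV_nonneg_imp_nondecreasing[OF that]) auto
    qed simp
    thus False using prob_density_not_bounded_below[OF assms(1) fpos[of 0]] by (meson not_less)
  qed
  have stat: "(\<Sum>i<m. \<phi> (x i - loc_mle f m x)) = 0" if "m > 0" for m x
    by (rule mle_stationary_and_maximal(1)[OF fpos der cont mono \<phi>0 that])
  have max: "(\<Sum>i<m. ln (f (x i - \<theta>))) \<le> (\<Sum>i<m. ln (f (x i - loc_mle f m x)))" if "m > 0" for m x \<theta>
    by (rule mle_stationary_and_maximal(2)[OF fpos der cont mono \<phi>0 that])
  \<comment> \<open>Here \<open>ln g\<close> is an increasing affine function of
    \<open>ln f\<close>, so maximizers carry over.\<close>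
  have "mle_coincide f g m" if c: "c > 0" and d: "d > 0" and g: "\<And>x. g x = c * f x powr d"
    and "m > 0" for c d m
  proof -
    have "ln (g x) = ln c + d * ln (f x)" for x
      using c fpos[of x] by (simp add: g ln_mult ln_powr)
    thus ?thesis
      using max[OF that(4)] d by (simp add: mle_coincide_def sum.distrib flip: sum_distrib_left)
  qed
  moreover have "\<exists>c>0. \<exists>d>0. \<forall>x. g x = c * f x powr d"
    if co2: "mle_coincide f g 2" and con: "mle_coincide f g n"
  proof -
    define v where "v = (\<lambda>x. - ln (g x))"
    have contv: "continuous_on UNIV v"
      unfolding v_def using gpos less_imp_neq by (intro continuous_intros assms(5)) fastforce
    have minimal: "(\<Sum>i<m. v (x i - loc_mle f m x)) \<le> (\<Sum>i<m. v (x i - \<theta>))"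
      if "mle_coincide f g m" for m x \<theta>
      using that by (simp add: mle_coincide_def v_def sum_negf)
    have pair: "v a + v (- a) \<le> v (a + t) + v (- a + t)" for a t
    proof -
      define x where "x = (\<lambda>i::nat. if i = 0 then a else - a)"
      have s2: "(\<Sum>i<2. h (x i)) = h a + h (- a)" for h :: "real \<Rightarrow> real"
        by (simp add: x_def numeral_2_eq_2)
      \<comment> \<open>Stationarity and oddness give this equality; injectivity then forces the MLE
        of \<open>a, - a\<close> to be 0.\<close>
      have "\<phi> (a - loc_mle f 2 x) = \<phi> (a + loc_mle f 2 x)"
        using stat[of 2 x] s2[of "\<lambda>y. \<phi> (y - loc_mle f 2 x)"] odd[of "a + loc_mle f 2 x"] by simp
      hence "loc_mle f 2 x = 0" using strict_mono_eq[OF mono] by fastforce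
      thus ?thesis
        using minimal[OF co2, of x "- t"] s2[of v] s2[of "\<lambda>y. v (y + t)"] by simp
    qed
    note even = even_convex_if_symmetric_pairs_minimal(1)[OF contv pair]
    obtain p where sub: "\<And>x y. v x + p x * (y - x) \<le> v y" and oddp: "\<And>x. p (- x) = - p x"
      using even_convex_odd_subgradient[OF even_convex_if_symmetric_pairs_minimal(2)[OF contv pair] even]
      by blast
    have key: "0 \<le> (\<Sum>i<n. p (x i))" if "0 < (\<Sum>i<n. \<phi> (x i))" for x
    proof -
      define \<theta> where "\<theta> = loc_mle f n x"
      have "\<theta> > 0"
      proof (rule ccontr)
        assume "\<not> \<theta> > 0"
        hence "(\<Sum>i<n. \<phi> (x i)) \<le> (\<Sum>i<n. \<phi> (x i - \<theta>))"
          using strict_mono_less_eq[OF mono] by (intro sum_mono) auto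
        thus False using stat[of n x] that assms(11) by (simp add: \<theta>_def)
      qed
      \<comment> \<open>The subgradient bounds are evaluated at the shifted points; since
        \<open>\<theta>\<close> is at least as good for \<open>g\<close> as 0,
        \<open>\<theta>\<close> times the sum of the \<open>p (x i)\<close> is nonnegative.\<close>
      have "(\<Sum>i<n. v (x i)) - \<theta> * (\<Sum>i<n. p (x i))
          = (\<Sum>i<n. v (x i) + p (x i) * ((x i - \<theta>) - x i))"
        by (simp add: sum_subtractf sum_distrib_left mult.commute)
      also have "\<dots> \<le> (\<Sum>i<n. v (x i - \<theta>))" by (intro sum_mono sub)
      also have "\<dots> \<le> (\<Sum>i<n. v (x i))" using minimal[OF con, of x 0] by (simp add: \<theta>_def)
      finally show ?thesis using \<open>\<theta> > 0\<close> by (simp add: zero_le_mult_iff)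
    qed
    have p0: "p 0 = 0" using oddp[of 0] by simp
    have subadd: "p c \<le> p a + p b" if "\<phi> c < \<phi> a + \<phi> b" for a b c
    proof -
      \<comment> \<open>Padding with zeros, where \<open>\<phi>\<close> and \<open>p\<close> vanish,
        reduces size \<open>n\<close> to three observations.\<close>
      define x where "x = (\<lambda>i::nat. if i = 0 then a else if i = 1 then b else if i = 2 then - c else 0)"
      have s3: "(\<Sum>i<n. h (x i)) = h a + h b + h (- c)" if "h 0 = 0" for h :: "real \<Rightarrow> real"
      proof -
        have "(\<Sum>i<n. h (x i)) = (\<Sum>i<3. h (x i))"
          using assms(11) by (intro sum.mono_neutral_right) (auto simp: x_def that)
        thus ?thesis by (simp add: x_def numeral_3_eq_3)
      qed
      show ?thesis using key[of x] that by (simp add: s3 \<phi>0 p0 odd oddp)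
    qed
    obtain d where d: "d \<ge> 0" "\<And>x. p x = d * \<phi> x"
      using odd_subadditive_imp_proportional[where p = p, OF cont mono odd oddp subadd] by blast
    \<comment> \<open>Proportionality transfers continuity from \<open>\<phi>\<close> to
      \<open>p\<close>, so the chosen subgradient is the derivative of \<open>v\<close>.\<close>
    have "isCont p x" for x
      unfolding d(2) using cont by (auto simp: continuous_on_eq_continuous_at intro!: continuous_intros)
    hence derv: "(v has_real_derivative d * \<phi> x) (at x)" for x
      using continuous_subgradient_imp_DERIV[of v p x, OF sub] by (simp add: d(2))
    have "((\<lambda>x. v x - d * - ln (f x)) has_real_derivative 0) (at x)" for x
      by (rule derivative_eq_intros derv der refl | simp)+
    hence "v x - d * - ln (f x) = v 0 - d * - ln (f 0)" for x
      using DERIV_isconst_all[of "\<lambda>x. v x - d * - ln (f x)" x 0] by blast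
    hence lng: "ln (g x) = (ln (g 0) - d * ln (f 0)) + d * ln (f x)" for x
      by (simp add: v_def algebra_simps)
    define c where "c = exp (ln (g 0) - d * ln (f 0))"
    have "c > 0" by (simp add: c_def)
    have g: "g x = c * f x powr d" for x
    proof -
      have "g x = exp (ln (g x))" using gpos by simp
      also have "\<dots> = c * f x powr d" unfolding lng[of x] exp_add c_def powr_def using fne by simp
      finally show ?thesis .
    qed
    have "d \<noteq> 0"
    proof
      assume "d = 0"
      hence "g x = c" for x using fne by (simp add: g)
      thus False using prob_density_not_bounded_below[OF assms(4) \<open>c > 0\<close>] by auto
    qed
    thus ?thesis using d(1) g \<open>c > 0\<close> by (intro exI[of _ c] exI[of _ d] conjI) auto
  qed
  ultimately have "mle_coincide f g 2 \<and> mle_coincide f g n \<longleftrightarrow>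
      (\<exists>c>0. \<exists>d>0. \<forall>x. g x = c * f x powr d)"
    using assms(11) by (metis gr0I not_numeral_le_zero zero_less_numeral)
  thus ?thesis using assms(4) by (simp add: loc_class_def)
qed

end
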